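(* Let $q\ge 2$ and $L\ge 1$ be integers. Then $$\mathrm{DC}(q,L)\;\ge\; \frac{q-1}{2(q+1)}\cdot\left(\frac{1}{\sigma_{q-1}\cdot (q-1)!}\right)^{\frac{2}{q-1}}\cdot\left(\frac1L\right)^{\frac{2}{q-1}} .$$ Moreover, this bound is attained in the limit by a sequence of symmetric channels with uniform input distribution: there is a sequence $(W_M)_{M\ge 1}$ of symmetric channels with input alphabet of size $q$ and finite output alphabets such that, when $P_X$ is the uniform distribution on the input alphabet, $$\liminf_{M\to\infty}\ \min_{\substack{Q:\ Q\prec W_M,\\ |\mathrm{out}(Q)|\le L}}\bigl(I(W_M)-I(Q)\bigr)\;\ge\;\frac{q-1}{2(q+1)}\cdot\left(\frac{1}{\sigma_{q-1}\cdot (q-1)!}\right)^{\frac{2}{q-1}}\cdot\left(\frac1L\right)^{\frac{2}{q-1}} .$$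
   Context: A channel $W\colon\mathcal X\to\mathcal Y$ with finite input alphabet $\mathcal X$, $|\mathcal X|=q$, and finite output alphabet $\mathrm{out}(W)=\mathcal Y$ is given by transition probabilities $W(y|x)\ge 0$ with $\sum_{y\in\mathcal Y}W(y|x)=1$ for each $x\in\mathcal X$. Given an input distribution $P_X$ on $\mathcal X$, let $X\sim P_X$ be the input and $Y$ the output of $W$; $I(W)=I(X;Y)$ denotes their mutual information, measured in nats (all logarithms are natural). A channel $Q\colon\mathcal X\to\mathcal Z$ is (stochastically) degraded with respect to $W\colon\mathcal X\to\mathcal Y$, written $Q\prec W$, if there is a channel $\Phi\colon\mathcal Y\to\mathcal Z$ with $Q(z|x)=\sum_{y\in\mathcal Y}W(y|x)\Phi(z|y)$ for all $x\in\mathcal X$, $z\in\mathcal Z$. The degrading cost is $$\mathrm{DC}(q,L)=\sup_{W,P_X}\ \min_{\substack{Q:\ Q\prec W,\\ |\mathrm{out}(Q)|\le L}}\bigl(I(W)-I(Q)\bigr),$$ where $W$ and $Q$ range over channels with the same input alphabet $\mathcal X$ of size $q$ and finite output alphabets, $P_X$ ranges over all probability distributions on $\mathcal X$, and $I(W)$ and $I(Q)$ are computed with the same input distribution $P_X$. A channel $W\colon\mathcal X\to\mathcal Y$ is symmetric if $\mathcal Y$ can be partitioned into sets such that, for each set of the partition, the submatrix of the matrix $(W(y|x))_{x\in\mathcal X,y\in\mathcal Y}$ formed by the columns indexed by that set has the property that every row is a permutation of its first row and every column is a permutation of its first column. $\sigma_{q-1}=\pi^{(q-1)/2}/\Gamma\!\left(\frac{q-1}{2}+1\right)$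 is the constant such that a ball of radius $r$ in $\mathbb R^{q-1}$ has volume $\sigma_{q-1}r^{q-1}$. *)

theory Defs
  imports "HOL-Probability.Probability"
begin

text \<open>
  A channel \<open>W\<close> with finite input alphabet \<open>X\<close> and finite output alphabet \<open>Y\<close> is given by its
  transition probabilities, \<open>W x y\<close> standing for \<open>W(y|x)\<close>.  Values outside \<open>X \<times> Y\<close> are irrelevant.
\<close>

definition channel :: "'a set \<Rightarrow> 'b set \<Rightarrow> ('a \<Rightarrow> 'b \<Rightarrow> real) \<Rightarrow> bool" where
  "channel X Y W \<longleftrightarrow> finite X \<and> finite Y \<and>
     (\<forall>x\<in>X. \<forall>y\<in>Y. 0 \<le> W x y) \<and> (\<forall>x\<in>X. (\<Sum>y\<in>Y. W x y) = 1)"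

definition input_distribution :: "'a set \<Rightarrow> ('a \<Rightarrow> real) \<Rightarrow> bool" where
  "input_distribution X P \<longleftrightarrow> finite X \<and> (\<forall>x\<in>X. 0 \<le> P x) \<and> (\<Sum>x\<in>X. P x) = 1"

definition degraded ::
  "'a set \<Rightarrow> 'b set \<Rightarrow> ('a \<Rightarrow> 'b \<Rightarrow> real) \<Rightarrow> 'c set \<Rightarrow> ('a \<Rightarrow> 'c \<Rightarrow> real) \<Rightarrow> bool" where
  "degraded X Y W Z Q \<longleftrightarrow>
     (\<exists>\<Phi>. channel Y Z \<Phi> \<and> (\<forall>x\<in>X. \<forall>z\<in>Z. Q x z = (\<Sum>y\<in>Y. W x y * \<Phi> y z)))"

text \<open>
  Mutual information of input and output, the two coordinates of the joint distribution
  \<open>P x * W x y\<close> on \<open>X \<times> Y\<close>; the base \<open>exp 1\<close> of the logarithm gives nats.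
\<close>

definition channel_mi ::
  "'a set \<Rightarrow> ('a \<Rightarrow> real) \<Rightarrow> 'b set \<Rightarrow> ('a \<Rightarrow> 'b \<Rightarrow> real) \<Rightarrow> real" where
  "channel_mi X P Y W =
     prob_space.mutual_information (point_measure (X \<times> Y) (\<lambda>(x, y). ennreal (P x * W x y)))
       (exp 1) (count_space X) (count_space Y) fst snd"

text \<open>
  Output alphabets are finite sets of natural numbers; up to relabelling these are all finite
  alphabets.  The infimum below is a minimum, see \<open>min_degrading_loss_attained\<close>.
\<close>

definition min_degrading_loss ::
  "'a set \<Rightarrow> ('a \<Rightarrow> real) \<Rightarrow> nat \<Rightarrow> 'b set \<Rightarrow> ('a \<Rightarrow> 'b \<Rightarrow> real) \<Rightarrow> ereal" where
  "min_degrading_loss X P L Y W =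
     (INF (Z, Q) \<in> {(Z :: nat set, Q). channel X Z Q \<and> degraded X Y W Z Q \<and> card Z \<le> L}.
        ereal (channel_mi X P Y W - channel_mi X P Z Q))"

definition degrading_cost :: "nat \<Rightarrow> nat \<Rightarrow> ereal" where
  "degrading_cost q L =
     (SUP (P, Y, W) \<in> {(P, Y :: nat set, W). input_distribution {..<q} P \<and> channel {..<q} Y W}.
        min_degrading_loss {..<q} P L Y W)"

text \<open>
  Any two rows (columns) of each submatrix are permutations of each other, which amounts to all
  of them being permutations of the first one.
\<close>

definition symmetric_channel :: "'a set \<Rightarrow> 'b set \<Rightarrow> ('a \<Rightarrow> 'b \<Rightarrow> real) \<Rightarrow> bool" where
  "symmetric_channel X Y W \<longleftrightarrow> channel X Y W \<and>
     (\<exists>\<P>. partition_on Y \<P> \<and>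
       (\<forall>B\<in>\<P>.
         (\<forall>x\<in>X. \<forall>x'\<in>X. \<exists>\<pi>. \<pi> permutes B \<and> (\<forall>y\<in>B. W x' y = W x (\<pi> y))) \<and>
         (\<forall>y\<in>B. \<forall>y'\<in>B. \<exists>\<pi>. \<pi> permutes X \<and> (\<forall>x\<in>X. W x y' = W (\<pi> x) y))))"

text \<open>
  Here \<open>unit_ball_vol (q - 1)\<close> is, by definition,
  \<open>\<pi> powr ((q - 1) / 2) / \<Gamma> ((q - 1) / 2 + 1)\<close>.
\<close>

definition dc_bound :: "nat \<Rightarrow> nat \<Rightarrow> real" where
  "dc_bound q L =
     (real q - 1) / (2 * (real q + 1))
     * (1 / (unit_ball_vol (real q - 1) * fact (q - 1))) powr (2 / (real q - 1))
     * (1 / real L) powr (2 / (real q - 1))"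


subsection \<open>The minimum is attained\<close>

lemma channel_mi_eq:
  assumes P: "input_distribution X P" and W: "channel X Y W"
  shows "channel_mi X P Y W =
    (\<Sum>y\<in>Y. (\<Sum>x\<in>X. P x * (W x y * ln (W x y)))
             - (\<Sum>x\<in>X. P x * W x y) * ln (\<Sum>x\<in>X. P x * W x y))"
proof -
  define p where "p = (\<lambda>(x, y). P x * W x y)"
  define R where "R y = (\<Sum>x\<in>X. P x * W x y)" for y
  define M where "M = point_measure (X \<times> Y) (\<lambda>z. ennreal (p z))"
  have fin [simp]: "finite X" "finite Y" and Pnn: "\<And>x. x \<in> X \<Longrightarrow> 0 \<le> P x"
    and Wnn: "\<And>x y. x \<in> X \<Longrightarrow> y \<in> Y \<Longrightarrow> 0 \<le> W x y"
    and W1: "\<And>x. x \<in> X \<Longrightarrow> (\<Sum>y\<in>Y. W x y) = 1" and P1: "(\<Sum>x\<in>X. P x) = 1"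
    using P W by (auto simp: input_distribution_def channel_def)
  have pnn: "0 \<le> p z" if "z \<in> X \<times> Y" for z
    using that Pnn Wnn by (auto simp: p_def)
  have ne: "X \<noteq> {}" using P1 by auto
  with W1 have ne': "Y \<noteq> {}" by fastforce
  have X1: "(\<Sum>y\<in>Y. p (x, y)) = P x" if "x \<in> X" for x
    using W1[OF that] by (simp add: p_def flip: sum_distrib_left)
  have p1: "sum p (X \<times> Y) = 1"
    using X1 P1 by (subst sum.cartesian_product') simp
  have meas: "measure M A = sum p A" if "A \<subseteq> X \<times> Y" for A
    unfolding M_def measure_def using that pnn
    by (subst emeasure_point_measure_finite) (auto simp: subset_eq sum_nonneg)
  interpret prob_space M
    by standard (simp add: M_def space_point_measure emeasure_point_measure_finite pnn p1 sum_nonneg)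
  interpret information_space M "exp 1"
    by standard simp
  have sp: "space M = X \<times> Y"
    by (simp add: M_def space_point_measure)
  have fstM: "fst ` space M = X" and sndM: "snd ` space M = Y"
    using ne ne' by (auto simp: sp)
  have sX: "simple_distributed M fst (\<lambda>x. if x \<in> X then P x else 0)"
  proof (rule simple_distributedI)
    show "simple_function M fst" by (simp add: M_def)
    show "0 \<le> (if x \<in> X then P x else 0)" for x by (simp add: Pnn)
    fix x assume "x \<in> fst ` space M"
    then have x: "x \<in> X" by (simp add: fstM)
    have "fst -` {x} \<inter> space M = Pair x ` Y" using x by (auto simp: sp)
    then show "(if x \<in> X then P x else 0) = measure M (fst -` {x} \<inter> space M)"
      using x by (simp add: meas image_subset_iff sum.reindex inj_on_def X1)
  qed
  have sY: "simple_distributed M snd (\<lambda>y. if y \<in> Y then R y else 0)"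
  proof (rule simple_distributedI)
    show "simple_function M snd" by (simp add: M_def)
    show "0 \<le> (if y \<in> Y then R y else 0)" for y
      by (auto simp: R_def intro!: sum_nonneg Pnn Wnn mult_nonneg_nonneg)
    fix y assume "y \<in> snd ` space M"
    then have y: "y \<in> Y" by (simp add: sndM)
    have "snd -` {y} \<inter> space M = (\<lambda>x. (x, y)) ` X" using y by (auto simp: sp)
    then show "(if y \<in> Y then R y else 0) = measure M (snd -` {y} \<inter> space M)"
      using y by (simp add: meas image_subset_iff sum.reindex inj_on_def R_def p_def)
  qed
  have sXY: "simple_distributed M (\<lambda>z. (fst z, snd z))
      (\<lambda>z. if z \<in> X \<times> Y then p z else 0)"
  proof (rule simple_distributedI)
    show "simple_function M (\<lambda>z. (fst z, snd z))" by (simp add: M_def)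
    show "0 \<le> (if z \<in> X \<times> Y then p z else 0)" for z by (simp add: pnn)
    fix z assume "z \<in> (\<lambda>z. (fst z, snd z)) ` space M"
    then have z: "z \<in> X \<times> Y" by (simp add: sp)
    have "(\<lambda>z. (fst z, snd z)) -` {z} \<inter> space M = {z}" using z by (auto simp: sp)
    then show "(if z \<in> X \<times> Y then p z else 0) = measure M ((\<lambda>z. (fst z, snd z)) -` {z} \<inter> space M)"
      using z by (simp add: meas)
  qed
  have "channel_mi X P Y W = mutual_information (exp 1) (count_space (fst ` space M))
      (count_space (snd ` space M)) fst snd"
    unfolding channel_mi_def fstM sndM by (simp add: M_def p_def case_prod_unfold)
  also have "\<dots> = (\<Sum>(x, y)\<in>X \<times> Y. p (x, y) * ln (p (x, y) / (P x * R y)))"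
    by (subst mutual_information_simple_distributed[OF sX sY sXY], rule sum.cong)
       (auto simp: sp log_ln)
  also have "\<dots> = (\<Sum>(x, y)\<in>X \<times> Y. P x * (W x y * ln (W x y)) - P x * W x y * ln (R y))"
  proof (intro sum.cong refl, clarify)
    fix x y assume xy: "x \<in> X" "y \<in> Y"
    show "p (x, y) * ln (p (x, y) / (P x * R y)) =
        P x * (W x y * ln (W x y)) - P x * W x y * ln (R y)"
    proof (cases "P x * W x y = 0")
      case True
      then show ?thesis by (auto simp: p_def)
    next
      case False
      then have pos: "0 < P x" "0 < W x y"
        using Pnn[OF xy(1)] Wnn[OF xy] by (auto simp: less_le)
      have "P x * W x y \<le> R y"
        unfolding R_def using xy Pnn Wnn
        by (intro member_le_sum[of x X "\<lambda>x. P x * W x y"]) auto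
      then have "0 < R y"
        using pos by (smt (verit) mult_pos_pos)
      then show ?thesis
        using pos by (simp add: p_def ln_div algebra_simps)
    qed
  qed
  also have "\<dots> = (\<Sum>y\<in>Y. \<Sum>x\<in>X. P x * (W x y * ln (W x y)) - P x * W x y * ln (R y))"
    by (subst sum.swap) (simp only: sum.cartesian_product)
  finally show ?thesis
    by (simp add: sum_subtractf sum_distrib_right R_def)
qed

lemma continuous_on_xlnx: "continuous_on {0..} (\<lambda>t::real. t * ln t)"
proof -
  have "((\<lambda>t::real. t * ln t) \<longlongrightarrow> 0) (at 0 within {0..})"
  proof -
    have "((\<lambda>t::real. t * ln t) \<longlongrightarrow> 0) (at_right 0)"
      by real_asymp
    moreover have "at (0::real) within {0..} = at_right 0"
      by (rule at_within_nhd[of _ UNIV]) auto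
    ultimately show ?thesis by simp
  qed
  moreover have "((\<lambda>t::real. t * ln t) \<longlongrightarrow> x * ln x) (at x within {0..})" if "x > 0" for x
    using that by (auto intro!: tendsto_intros)
  ultimately show ?thesis
    unfolding continuous_on_def by (metis atLeast_iff less_le mult_zero_left)
qed

lemma compact_fun:
  fixes A :: "'i \<Rightarrow> ('b::topological_space) set"
  assumes "\<And>i. compact (A i)"
  shows "compact {f. \<forall>i. f i \<in> A i}"
proof -
  have "compactin (product_topology (\<lambda>_. euclidean) UNIV) (PiE UNIV A)"
    unfolding compactin_PiE using assms by simp
  moreover have "PiE UNIV A = {f. \<forall>i. f i \<in> A i}"
    by (auto simp: PiE_def)
  ultimately show ?thesis
    by (simp add: euclidean_product_topology)
qed

lemma channel_compose:
  assumes "channel X Y W" "channel Y Z \<Phi>"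
  shows "channel X Z (\<lambda>x z. \<Sum>y\<in>Y. W x y * \<Phi> y z)"
proof -
  have "(\<Sum>z\<in>Z. \<Sum>y\<in>Y. W x y * \<Phi> y z) = 1" if "x \<in> X" for x
    using assms that
    by (subst sum.swap) (simp add: channel_def flip: sum_distrib_left)
  then show ?thesis
    using assms by (auto simp: channel_def intro!: sum_nonneg)
qed

lemma min_degrading_loss_attained:
  assumes P: "input_distribution X P" and W: "channel X Y W" and L: "1 \<le> L"
  shows "\<exists>(Z :: nat set) Q. channel X Z Q \<and> degraded X Y W Z Q \<and> card Z \<le> L \<and>
    min_degrading_loss X P L Y W = ereal (channel_mi X P Y W - channel_mi X P Z Q)"
proof -
  define h :: "real \<Rightarrow> real" where "h = (\<lambda>t. t * ln t)"
  define C where "C \<Phi> = (\<lambda>x z. \<Sum>y\<in>Y. W x y * \<Phi> y z)" for \<Phi> :: "'b \<Rightarrow> nat \<Rightarrow> real"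
  define G where "G \<Phi> = (\<Sum>z<L. (\<Sum>x\<in>X. P x * h (C \<Phi> x z)) - h (\<Sum>x\<in>X. P x * C \<Phi> x z))"
    for \<Phi>
  define A where "A y = (if y \<in> Y then
      {g. \<forall>z. g z \<in> (if z < L then {0..1} else {0})} \<inter> {g. sum g {..<L} = 1}
      else {\<lambda>_. 0 :: real})" for y
  have A_iff: "g \<in> A y \<longleftrightarrow> (if y \<in> Y
      then (\<forall>z. g z \<in> (if z < L then {0..1} else {0})) \<and> (\<Sum>z<L. g z) = 1
      else g = (\<lambda>_. 0))" for g y
    by (simp only: A_def split: if_split) blast
  define K :: "('b \<Rightarrow> nat \<Rightarrow> real) set" where "K = {\<Phi>. \<forall>y. \<Phi> y \<in> A y}"
  have Wch: "finite X" "finite Y" "\<And>x y. x \<in> X \<Longrightarrow> y \<in> Y \<Longrightarrow> 0 \<le> W x y"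
    and Pnn: "\<And>x. x \<in> X \<Longrightarrow> 0 \<le> P x"
    using P W by (auto simp: channel_def input_distribution_def)
  have cA: "compact (A y)" for y
  proof -
    have "closed {g :: nat \<Rightarrow> real. sum g {..<L} = 1}"
      by (intro closed_Collect_eq continuous_intros continuous_on_product_coordinates)
    moreover have "compact {g :: nat \<Rightarrow> real. \<forall>z. g z \<in> (if z < L then {0..1} else {0})}"
      by (rule compact_fun) simp
    ultimately have "compact ({g :: nat \<Rightarrow> real. \<forall>z. g z \<in> (if z < L then {0..1} else {0})}
        \<inter> {g. sum g {..<L} = 1})"
      by (rule compact_Int_closed[rotated])
    then show ?thesis
      by (simp only: A_def compact_sing split: if_split) simp
  qed
  have cK: "compact K"
    unfolding K_def by (rule compact_fun[OF cA])
  have Kch: "channel Y {..<L} \<Phi>" if "\<Phi> \<in> K" for \<Phi>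
    unfolding channel_def
  proof (intro conjI ballI)
    fix y assume y: "y \<in> Y"
    with that have mem: "\<Phi> y \<in> A y" by (auto simp: K_def)
    then show "(\<Sum>z<L. \<Phi> y z) = 1"
      using y by (auto simp: A_def)
    fix z assume "z \<in> {..<L}"
    then show "0 \<le> \<Phi> y z"
      using y mem by (auto simp: A_def dest: spec[of _ z])
  qed (use Wch in auto)
  have "(\<lambda>y z. if y \<in> Y \<and> z = 0 then 1 else 0) \<in> K"
    unfolding K_def mem_Collect_eq A_iff
  proof (intro allI)
    fix y
    show "if y \<in> Y
      then (\<forall>z. (if y \<in> Y \<and> z = 0 then 1 else 0 :: real) \<in> (if z < L then {0..1} else {0})) \<and>
        (\<Sum>z<L. if y \<in> Y \<and> z = 0 then 1 else 0 :: real) = 1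
      else (\<lambda>z. if y \<in> Y \<and> z = 0 then 1 else 0 :: real) = (\<lambda>_. 0)"
      using L by (cases "y \<in> Y") simp_all
  qed
  then have "K \<noteq> {}" by blast
  have cC: "continuous_on K (\<lambda>\<Phi>. C \<Phi> x z)" for x z
  proof -
    have "continuous_on K (\<lambda>\<Phi>. \<Phi> y z)" for y
      by (rule continuous_on_product_then_coordinatewise[OF
            continuous_on_product_then_coordinatewise[OF continuous_on_id]])
    then show ?thesis
      unfolding C_def by (intro continuous_on_sum continuous_on_mult_left)
  qed
  have ch: "continuous_on K (\<lambda>\<Phi>. h (f \<Phi>))" if "continuous_on K f" "\<And>\<Phi>. \<Phi> \<in> K \<Longrightarrow> 0 \<le> f \<Phi>" for f
    unfolding h_def
    by (rule continuous_on_compose2[OF continuous_on_xlnx that(1)]) (use that(2) in auto)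
  have Cnn: "0 \<le> C \<Phi> x z" if "\<Phi> \<in> K" "x \<in> X" "z < L" for \<Phi> x z
    using Kch[OF that(1)] that Wch by (auto simp: C_def channel_def intro!: sum_nonneg)
  have "continuous_on K G"
    unfolding G_def
    by (intro continuous_intros ch cC)
       (auto intro!: sum_nonneg mult_nonneg_nonneg Cnn Pnn)
  then obtain \<Phi>0 where \<Phi>0: "\<Phi>0 \<in> K" and max: "\<And>\<Phi>. \<Phi> \<in> K \<Longrightarrow> G \<Phi> \<le> G \<Phi>0"
    using continuous_attains_sup[OF cK \<open>K \<noteq> {}\<close>] by blast
  have G_mi: "channel_mi X P {..<L} (C \<Phi>) = G \<Phi>" if "\<Phi> \<in> K" for \<Phi>
    using channel_mi_eq[OF P channel_compose[OF W Kch[OF that]]]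
    by (simp add: G_def C_def h_def)
  have deg0: "degraded X Y W {..<L} (C \<Phi>0)"
    using Kch[OF \<Phi>0] by (auto simp: degraded_def C_def)
  have ch0: "channel X {..<L} (C \<Phi>0)"
    unfolding C_def by (rule channel_compose[OF W Kch[OF \<Phi>0]])
  have le: "channel_mi X P Z Q \<le> G \<Phi>0"
    if Q: "channel X Z Q" "degraded X Y W Z Q" "card Z \<le> L" for Z :: "nat set" and Q
  proof -
    obtain \<Phi> where \<Phi>: "channel Y Z \<Phi>"
      and Q_eq: "\<And>x z. x \<in> X \<Longrightarrow> z \<in> Z \<Longrightarrow> Q x z = (\<Sum>y\<in>Y. W x y * \<Phi> y z)"
      using Q(2) by (auto simp: degraded_def)
    have "finite Z" using Q(1) by (simp add: channel_def)
    then obtain e where e: "bij_betw e {..<card Z} Z"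
      using ex_bij_betw_nat_finite by (metis atLeast0LessThan)
    define \<Psi> where "\<Psi> = (\<lambda>y z. if y \<in> Y \<and> z < card Z then \<Phi> y (e z) else 0)"
    have eZ: "e z \<in> Z" if "z < card Z" for z
      using e that by (auto simp: bij_betw_def)
    have sub: "{..<card Z} \<subseteq> {..<L}" using Q(3) by auto
    have sum1: "(\<Sum>z<L. \<Psi> y z) = 1" if "y \<in> Y" for y
    proof -
      have "(\<Sum>z<L. \<Psi> y z) = (\<Sum>z<card Z. \<Psi> y z)"
        by (rule sum.mono_neutral_right) (use sub in \<open>auto simp: \<Psi>_def\<close>)
      also have "\<dots> = (\<Sum>z<card Z. \<Phi> y (e z))"
        using that by (simp add: \<Psi>_def)
      also have "\<dots> = (\<Sum>z\<in>Z. \<Phi> y z)"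
        by (rule sum.reindex_bij_betw[OF e])
      finally show ?thesis using \<Phi> that by (simp add: channel_def)
    qed
    have le1: "\<Phi> y z \<le> 1" if "y \<in> Y" "z \<in> Z" for y z
      using \<Phi> that member_le_sum[of z Z "\<Phi> y"] by (auto simp: channel_def)
    have "\<Psi> \<in> K"
      unfolding K_def mem_Collect_eq A_iff
    proof (intro allI)
      fix y
      have "\<Psi> y z \<in> (if z < L then {0..1} else {0})" if "y \<in> Y" for z
        using that le1[OF that eZ, of z] eZ[of z] \<Phi> Q(3) by (auto simp: \<Psi>_def channel_def)
      then show "if y \<in> Y
        then (\<forall>z. \<Psi> y z \<in> (if z < L then {0..1} else {0})) \<and> (\<Sum>z<L. \<Psi> y z) = 1
        else \<Psi> y = (\<lambda>_. 0)"
        using sum1 by (cases "y \<in> Y") (simp_all add: \<Psi>_def)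
    qed
    have CQ: "C \<Psi> x z = Q x (e z)" if "x \<in> X" "z < card Z" for x z
      using that Q_eq[OF that(1) eZ[OF that(2)]] by (simp add: C_def \<Psi>_def)
    have C0: "C \<Psi> x z = 0" if "\<not> z < card Z" for x z
      using that by (simp add: C_def \<Psi>_def)
    have "channel_mi X P Z Q = (\<Sum>z\<in>Z. (\<Sum>x\<in>X. P x * h (Q x z)) - h (\<Sum>x\<in>X. P x * Q x z))"
      using channel_mi_eq[OF P Q(1)] by (simp add: h_def)
    also have "\<dots> = (\<Sum>z<card Z. (\<Sum>x\<in>X. P x * h (Q x (e z))) - h (\<Sum>x\<in>X. P x * Q x (e z)))"
      by (rule sum.reindex_bij_betw[OF e, symmetric])
    also have "\<dots> = (\<Sum>z<card Z. (\<Sum>x\<in>X. P x * h (C \<Psi> x z)) - h (\<Sum>x\<in>X. P x * C \<Psi> x z))"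
      by (simp add: CQ)
    also have "\<dots> = G \<Psi>"
      unfolding G_def
      by (rule sum.mono_neutral_left) (use sub in \<open>auto simp: C0 h_def\<close>)
    finally show ?thesis using max[OF \<open>\<Psi> \<in> K\<close>] by simp
  qed
  have "min_degrading_loss X P L Y W = ereal (channel_mi X P Y W - channel_mi X P {..<L} (C \<Phi>0))"
    unfolding min_degrading_loss_def
  proof (rule antisym)
    show "(INF (Z, Q)\<in>{(Z :: nat set, Q). channel X Z Q \<and> degraded X Y W Z Q \<and> card Z \<le> L}.
        ereal (channel_mi X P Y W - channel_mi X P Z Q))
        \<le> ereal (channel_mi X P Y W - channel_mi X P {..<L} (C \<Phi>0))"
      by (rule INF_lower2[of "({..<L}, C \<Phi>0)"]) (use deg0 ch0 in auto)
    show "ereal (channel_mi X P Y W - channel_mi X P {..<L} (C \<Phi>0)) \<le>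
      (INF (Z, Q)\<in>{(Z :: nat set, Q). channel X Z Q \<and> degraded X Y W Z Q \<and> card Z \<le> L}.
        ereal (channel_mi X P Y W - channel_mi X P Z Q))"
      by (rule INF_greatest) (use le G_mi[OF \<Phi>0] in auto)
  qed
  then show ?thesis
    using ch0 deg0 by (intro exI[of _ "{..<L}"] exI[of _ "C \<Phi>0"]) auto
qed

end

theory Submission
  imports Defs
begin

text \<open>
  Let the output be uniform over the compositions \<open>l\<close> of \<open>M\<close> into \<open>q = n + 1\<close> parts, with
  posterior \<open>l / M\<close>.  The loss of a degraded channel is a sum of Jensen gaps of \<open>t ln t\<close>, whose second
  derivative is at least 1 on the unit interval; so it is at least half the mean squared distance of
  the first \<open>n\<close> posterior coordinates to at most \<open>L\<close> centres.  Disjoint unit cubes around lattice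
  points show that a ball of radius \<open>t\<close> contains at most a fraction \<open>\<sigma> n! (t + \<surd>n / M)^n\<close> of the
  posteriors, where \<open>\<sigma>\<close> is the volume of the \<open>n\<close>-dimensional unit ball.
  Integrating the resulting tail bound for the distance against \<open>2 t dt\<close> and letting \<open>M\<close> tend
  to infinity yields the second moment of the balls of which \<open>L\<close> together have the volume \<open>1 / n!\<close> of
  the projected simplex.
\<close>

section \<open>From information loss to squared distances\<close>

text \<open>Fix \<open>p\<close> and move the point of tangency: the gap \<open>g\<close> between
  the two sides has derivative (t - p) (1 / t - 1), which on the unit interval has the sign of t - p
  or vanishes. So \<open>g\<close> is smallest at t = \<open>p\<close>, where it is 0.\<close>

lemma xlnx_tangent_bound:
  fixes p c :: real
  assumes p: "0 \<le> p" "p \<le> 1" and c: "0 < c" "c \<le> 1"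
  shows "c * ln c + (ln c + 1) * (p - c) + (p - c)\<^sup>2 / 2 \<le> p * ln p"
proof (cases "p = 0")
  case True
  \<comment> \<open>With \<open>p = 0\<close> the minimum would sit at t = 0, where \<open>g\<close>
    has no derivative; the claim itself reduces to c^2 / 2 \<le> c.\<close>
  have "c * c \<le> c * 1"
    using c by (intro mult_left_mono) auto
  then show ?thesis
    using True c by (simp add: power2_eq_square algebra_simps)
next
  case False
  define g where "g t = p * ln p - p * ln t - p + t - (p - t)\<^sup>2 / 2" for t
  have deriv: "(g has_real_derivative (t - p) * (1 / t - 1)) (at t)" if "0 < t" for t
    unfolding g_def using that
    by (auto intro!: derivative_eq_intros simp: field_simps power2_eq_square)
  have "g p \<le> g c"
  proof (cases "p \<le> c")
    case True
    show ?thesis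
    proof (rule DERIV_nonneg_imp_nondecreasing[OF True])
      fix t assume "p \<le> t" "t \<le> c"
      then show "\<exists>y. (g has_real_derivative y) (at t) \<and> 0 \<le> y"
        using deriv[of t] p c False by (intro exI[of _ "(t - p) * (1 / t - 1)"]) auto
    qed
  next
    case False
    then have "c \<le> p" by simp
    then show ?thesis
    proof (rule DERIV_nonpos_imp_nonincreasing)
      fix t assume "c \<le> t" "t \<le> p"
      then show "\<exists>y. (g has_real_derivative y) (at t) \<and> y \<le> 0"
        using deriv[of t] p c
        by (intro exI[of _ "(t - p) * (1 / t - 1)"]) (auto intro!: mult_nonpos_nonneg)
    qed
  qed
  then show ?thesis
    by (simp add: g_def algebra_simps)
qed

text \<open>Average the tangent bound at the weighted mean \<open>c\<close>; the linear term
  averages to 0 and the quadratic term survives.\<close>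

lemma xlnx_strong_jensen:
  fixes w p :: "'a \<Rightarrow> real"
  assumes fin: "finite Y" and w: "\<And>y. y \<in> Y \<Longrightarrow> 0 \<le> w y"
    and p: "\<And>y. y \<in> Y \<Longrightarrow> 0 \<le> p y" "\<And>y. y \<in> Y \<Longrightarrow> p y \<le> 1"
  defines "c \<equiv> (\<Sum>y\<in>Y. w y * p y) / sum w Y"
  shows "sum w Y * (c * ln c) + (\<Sum>y\<in>Y. w y * (p y - c)\<^sup>2) / 2 \<le> (\<Sum>y\<in>Y. w y * (p y * ln (p y)))"
\<comment> \<open>In the degenerate case \<open>c = 0\<close>, where no tangent exists. It includes
  total weight 0, where \<open>c\<close> is 0 by division by zero.\<close>
proof (cases "(\<Sum>y\<in>Y. w y * p y) = 0")
  case True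
  then have "w y = 0 \<or> p y = 0" if "y \<in> Y" for y
    using that fin w p by (subst (asm) sum_nonneg_eq_0_iff) auto
  then have "(\<Sum>y\<in>Y. w y * (p y)\<^sup>2) = 0" "(\<Sum>y\<in>Y. w y * (p y * ln (p y))) = 0"
    by (fastforce intro!: sum.neutral simp: power2_eq_square)+
  then show ?thesis
    using True by (simp add: c_def)
next
  case False
  have wp: "0 \<le> (\<Sum>y\<in>Y. w y * p y)"
    using w p by (intro sum_nonneg) auto
  have le: "(\<Sum>y\<in>Y. w y * p y) \<le> sum w Y"
    using w p by (intro sum_mono mult_left_le) auto
  have c: "0 < c" "c \<le> 1"
    using False wp le by (auto simp: c_def field_simps)
  have lin: "(\<Sum>y\<in>Y. w y * (p y - c)) = 0"
  proof -
    have "(\<Sum>y\<in>Y. w y * (p y - c)) = (\<Sum>y\<in>Y. w y * p y) - sum w Y * c"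
      by (simp add: right_diff_distrib sum_subtractf sum_distrib_right)
    then show ?thesis using False wp le by (simp add: c_def)
  qed
  have "sum w Y * (c * ln c) + (\<Sum>y\<in>Y. w y * (p y - c)\<^sup>2) / 2 =
      sum w Y * (c * ln c) + (ln c + 1) * (\<Sum>y\<in>Y. w y * (p y - c)) + (\<Sum>y\<in>Y. w y * (p y - c)\<^sup>2) / 2"
    by (simp add: lin)
  also have "\<dots> = (\<Sum>y\<in>Y. w y * (c * ln c + (ln c + 1) * (p y - c) + (p y - c)\<^sup>2 / 2))"
    by (simp only: sum_distrib_left sum_distrib_right sum_divide_distrib flip: sum.distrib)
       (simp add: algebra_simps)
  also have "\<dots> \<le> (\<Sum>y\<in>Y. w y * (p y * ln (p y)))"
    using xlnx_tangent_bound[OF p(1) p(2) c] w by (intro sum_mono mult_left_mono) auto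
  finally show ?thesis .
qed

text \<open>Here \<open>R\<close> is the output distribution and \<open>p x y\<close> the posterior probability of \<open>x\<close> given \<open>y\<close>.\<close>

lemma channel_mi_uniform:
  assumes W: "channel X Y W" and ne: "X \<noteq> {}"
    and R: "\<And>y. y \<in> Y \<Longrightarrow> 0 \<le> R y" and p: "\<And>x y. x \<in> X \<Longrightarrow> y \<in> Y \<Longrightarrow> 0 \<le> p x y"
    and eq: "\<And>x y. x \<in> X \<Longrightarrow> y \<in> Y \<Longrightarrow> W x y = real (card X) * R y * p x y"
    and p1: "\<And>y. y \<in> Y \<Longrightarrow> R y * (\<Sum>x\<in>X. p x y) = R y"
  shows "channel_mi X (\<lambda>_. 1 / real (card X)) Y W =
    ln (real (card X)) + (\<Sum>y\<in>Y. R y * (\<Sum>x\<in>X. p x y * ln (p x y)))"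
proof -
  define q where "q = real (card X)"
  have fin: "finite X" using W by (simp add: channel_def)
  then have q: "q > 0" using ne by (simp add: q_def card_gt_0_iff)
  have P: "input_distribution X (\<lambda>_. 1 / q)"
    using fin q by (auto simp: input_distribution_def q_def)
  have out: "(\<Sum>x\<in>X. 1 / q * W x y) = R y" if "y \<in> Y" for y
    using that p1[OF that] q by (simp add: eq flip: q_def sum_distrib_left)
  have "(\<Sum>y\<in>Y. R y) = (\<Sum>y\<in>Y. \<Sum>x\<in>X. 1 / q * W x y)"
    by (intro sum.cong refl out[symmetric])
  also have "\<dots> = (\<Sum>x\<in>X. 1 / q * (\<Sum>y\<in>Y. W x y))"
    by (subst sum.swap) (simp add: sum_distrib_left)
  also have "\<dots> = 1"
    using W ne fin by (simp add: channel_def q_def)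
  finally have R1: "(\<Sum>y\<in>Y. R y) = 1" .
  \<comment> \<open>The logarithm of \<open>W x y\<close> splits into three summands; the one with
    \<open>ln (R y)\<close> cancels later against the output term.\<close>
  have term_eq: "1 / q * (W x y * ln (W x y)) = R y * p x y * (ln q + ln (R y)) + R y * (p x y * ln (p x y))"
    if "x \<in> X" "y \<in> Y" for x y
  proof (cases "R y = 0 \<or> p x y = 0")
    case True
    then show ?thesis using that by (auto simp: eq)
  next
    case False
    then have "0 < R y" "0 < p x y" using R p that by (auto simp: less_le)
    then show ?thesis using q that by (simp add: eq ln_mult algebra_simps flip: q_def)
  qed
  have "channel_mi X (\<lambda>_. 1 / q) Y W =
    (\<Sum>y\<in>Y. (\<Sum>x\<in>X. 1 / q * (W x y * ln (W x y))) - R y * ln (R y))"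
    by (subst channel_mi_eq[OF P W], intro sum.cong refl) (simp only: out)
  also have "\<dots> = (\<Sum>y\<in>Y. R y * ln q + R y * (\<Sum>x\<in>X. p x y * ln (p x y)))"
  proof (intro sum.cong refl)
    fix y assume y: "y \<in> Y"
    have "(\<Sum>x\<in>X. 1 / q * (W x y * ln (W x y))) =
      (\<Sum>x\<in>X. R y * p x y * (ln q + ln (R y))) + (\<Sum>x\<in>X. R y * (p x y * ln (p x y)))"
      using y by (subst sum.distrib[symmetric]) (intro sum.cong refl term_eq)
    also have "(\<Sum>x\<in>X. R y * p x y * (ln q + ln (R y))) = R y * (\<Sum>x\<in>X. p x y) * (ln q + ln (R y))"
      by (simp only: sum_distrib_left sum_distrib_right)
    also have "\<dots> = R y * (ln q + ln (R y))"
      by (simp only: p1[OF y])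
    finally show "(\<Sum>x\<in>X. 1 / q * (W x y * ln (W x y))) - R y * ln (R y) =
        R y * ln q + R y * (\<Sum>x\<in>X. p x y * ln (p x y))"
      by (simp add: sum_distrib_left distrib_left)
  qed
  also have "\<dots> = ln q + (\<Sum>y\<in>Y. R y * (\<Sum>x\<in>X. p x y * ln (p x y)))"
    by (simp add: sum.distrib R1 flip: sum_distrib_right)
  finally show ?thesis by (simp add: q_def)
qed

text \<open>The constant \<open>ln (real (card X))\<close> cancels between the two informations. An
  output \<open>z\<close> merges the outputs \<open>y\<close> with weights
  \<open>R y * \<Phi> y z\<close>, and its posterior is their weighted mean, the witness for
  \<open>c\<close>. What remains is one Jensen gap for each pair of \<open>z\<close> and
  \<open>x\<close>.\<close>

lemma degrading_loss_ge_quadratic: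
  assumes W: "channel X Y W" and ne: "X \<noteq> {}"
    and R: "\<And>y. y \<in> Y \<Longrightarrow> 0 \<le> R y" and p: "\<And>x y. x \<in> X \<Longrightarrow> y \<in> Y \<Longrightarrow> 0 \<le> p x y"
    and eq: "\<And>x y. x \<in> X \<Longrightarrow> y \<in> Y \<Longrightarrow> W x y = real (card X) * R y * p x y"
    and p1: "\<And>y. y \<in> Y \<Longrightarrow> (\<Sum>x\<in>X. p x y) = 1"
    and Q: "channel X Z Q" and \<Phi>: "channel Y Z \<Phi>"
    and QW: "\<And>x z. x \<in> X \<Longrightarrow> z \<in> Z \<Longrightarrow> Q x z = (\<Sum>y\<in>Y. W x y * \<Phi> y z)"
  shows "\<exists>c. (\<Sum>z\<in>Z. \<Sum>y\<in>Y. R y * \<Phi> y z * (\<Sum>x\<in>X. (p x y - c x z)\<^sup>2)) / 2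
    \<le> channel_mi X (\<lambda>_. 1 / real (card X)) Y W - channel_mi X (\<lambda>_. 1 / real (card X)) Z Q"
proof -
  define S where "S z = (\<Sum>y\<in>Y. R y * \<Phi> y z)" for z
  define c where "c x z = (\<Sum>y\<in>Y. R y * \<Phi> y z * p x y) / S z" for x z
  have fin: "finite X" "finite Y" "finite Z" using W Q by (auto simp: channel_def)
  have w: "0 \<le> R y * \<Phi> y z" if "y \<in> Y" "z \<in> Z" for y z
    using R \<Phi> that by (auto simp: channel_def)
  have S: "0 \<le> S z" if "z \<in> Z" for z
    using that w by (auto simp: S_def intro!: sum_nonneg)
  have c: "0 \<le> c x z" if "x \<in> X" "z \<in> Z" for x z
    unfolding c_def using that by (intro divide_nonneg_nonneg sum_nonneg mult_nonneg_nonneg[OF w p] S)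
  have Sc: "S z * c x z = (\<Sum>y\<in>Y. R y * \<Phi> y z * p x y)" if "x \<in> X" "z \<in> Z" for x z
  proof (cases "S z = 0")
    case True
    then have "\<And>y. y \<in> Y \<Longrightarrow> R y * \<Phi> y z = 0"
      unfolding S_def using fin w that by (subst (asm) sum_nonneg_eq_0_iff) auto
    then have "(\<Sum>y\<in>Y. R y * \<Phi> y z * p x y) = 0"
      by (simp add: sum.neutral)
    then show ?thesis using True by simp
  qed (simp add: c_def)
  have Q_eq: "Q x z = real (card X) * S z * c x z" if "x \<in> X" "z \<in> Z" for x z
  proof -
    have "Q x z = (\<Sum>y\<in>Y. real (card X) * (R y * \<Phi> y z * p x y))"
      using that by (simp add: QW eq mult_ac)
    then show ?thesis using Sc[OF that] by (simp add: mult.assoc flip: sum_distrib_left)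
  qed
  \<comment> \<open>If \<open>S z = 0\<close>, then \<open>c\<close> is 0 at \<open>z\<close> and no
    distribution, so normalisation holds only after multiplication by \<open>S z\<close>. The last
    hypothesis of \<open>channel_mi_uniform\<close> has this form for that reason.\<close>
  have Sc1: "S z * (\<Sum>x\<in>X. c x z) = S z" if "z \<in> Z" for z
  proof -
    have "S z * (\<Sum>x\<in>X. c x z) = (\<Sum>x\<in>X. \<Sum>y\<in>Y. R y * \<Phi> y z * p x y)"
      using that by (simp add: sum_distrib_left Sc)
    also have "\<dots> = (\<Sum>y\<in>Y. R y * \<Phi> y z * (\<Sum>x\<in>X. p x y))"
      by (subst sum.swap) (simp add: sum_distrib_left)
    finally show ?thesis using p1 by (simp add: S_def)
  qed
  have ple: "p x y \<le> 1" if "x \<in> X" "y \<in> Y" for x y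
    using member_le_sum[of x X "\<lambda>x. p x y"] p1[OF that(2)] that p fin by auto
  \<comment> \<open>Since each row of \<open>\<Phi>\<close> sums to 1, the information of
    \<open>W\<close> can be distributed over the outputs \<open>z\<close>.\<close>
  have "(\<Sum>y\<in>Y. R y * (\<Sum>x\<in>X. p x y * ln (p x y))) =
      (\<Sum>y\<in>Y. \<Sum>z\<in>Z. \<Phi> y z * (R y * (\<Sum>x\<in>X. p x y * ln (p x y))))"
    using \<Phi> by (simp add: channel_def flip: sum_distrib_right)
  also have "\<dots> = (\<Sum>z\<in>Z. \<Sum>x\<in>X. \<Sum>y\<in>Y. R y * \<Phi> y z * (p x y * ln (p x y)))"
    by (subst sum.swap, intro sum.cong refl, subst sum.swap) (simp add: sum_distrib_left mult_ac)
  finally have I: "(\<Sum>y\<in>Y. R y * (\<Sum>x\<in>X. p x y * ln (p x y))) =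
    (\<Sum>z\<in>Z. \<Sum>x\<in>X. \<Sum>y\<in>Y. R y * \<Phi> y z * (p x y * ln (p x y)))" .
  have "(\<Sum>z\<in>Z. \<Sum>y\<in>Y. R y * \<Phi> y z * (\<Sum>x\<in>X. (p x y - c x z)\<^sup>2)) / 2 =
     (\<Sum>z\<in>Z. \<Sum>x\<in>X. (\<Sum>y\<in>Y. R y * \<Phi> y z * (p x y - c x z)\<^sup>2) / 2)"
    unfolding sum_distrib_left sum_divide_distrib by (intro sum.cong refl, subst sum.swap) simp
  also have "\<dots> \<le> (\<Sum>z\<in>Z. \<Sum>x\<in>X. (\<Sum>y\<in>Y. R y * \<Phi> y z * (p x y * ln (p x y)))
      - S z * (c x z * ln (c x z)))"
  proof (intro sum_mono)
    fix z x assume "z \<in> Z" "x \<in> X"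
    then show "(\<Sum>y\<in>Y. R y * \<Phi> y z * (p x y - c x z)\<^sup>2) / 2 \<le>
      (\<Sum>y\<in>Y. R y * \<Phi> y z * (p x y * ln (p x y))) - S z * (c x z * ln (c x z))"
      using xlnx_strong_jensen[OF fin(2), of "\<lambda>y. R y * \<Phi> y z" "p x"] w p ple
      by (simp add: c_def S_def)
  qed
  also have "\<dots> = channel_mi X (\<lambda>_. 1 / real (card X)) Y W - channel_mi X (\<lambda>_. 1 / real (card X)) Z Q"
    using p1 channel_mi_uniform[of X Y W R p, OF W ne R p eq]
      channel_mi_uniform[of X Z Q S c, OF Q ne S c Q_eq Sc1] I
    by (simp add: sum_subtractf sum_distrib_left)
  finally show ?thesis by blast
qed

section \<open>Second moments and lattice point counts\<close>

text \<open>The square of \<open>min (d i) r\<close> is the integral of 2 t up to that point, so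
  summing over \<open>i\<close> leaves 2 t times the weight at distance beyond \<open>t\<close>,
  which \<open>F\<close> bounds from below. Cutting off at \<open>r\<close> only decreases the
  moment and restricts \<open>F\<close> to radii where it is informative.\<close>

lemma second_moment_layer_cake:
  fixes w d :: "'i \<Rightarrow> real" and F :: "real \<Rightarrow> real"
  assumes fin: "finite I" and w: "\<And>i. i \<in> I \<Longrightarrow> 0 \<le> w i" and d: "\<And>i. i \<in> I \<Longrightarrow> 0 \<le> d i"
    and r: "0 \<le> r"
    and F: "\<And>t. 0 \<le> t \<Longrightarrow> t \<le> r \<Longrightarrow> (\<Sum>i | i \<in> I \<and> d i \<le> t. w i) \<le> F t"
    and J: "((\<lambda>t. 2 * t * (sum w I - F t)) has_integral J) {0..r}"
  shows "J \<le> (\<Sum>i\<in>I. w i * (d i)\<^sup>2)"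
proof -
  have int1: "((\<lambda>t. if t \<in> {0..min (d i) r} then 2 * t else 0) has_integral (min (d i) r)\<^sup>2) {0..r}"
    if "i \<in> I" for i
  proof (subst has_integral_restrict)
    have "((\<lambda>t. 2 * t) has_integral ((min (d i) r)\<^sup>2 - 0\<^sup>2)) {0..min (d i) r}"
      using d[OF that] r
      by (intro fundamental_theorem_of_calculus)
         (auto intro!: derivative_eq_intros simp flip: has_real_derivative_iff_has_vector_derivative)
    then show "((\<lambda>t. 2 * t) has_integral (min (d i) r)\<^sup>2) {0..min (d i) r}" by simp
  qed auto
  have "((\<lambda>t. \<Sum>i\<in>I. w i * (if t \<in> {0..min (d i) r} then 2 * t else 0))
      has_integral (\<Sum>i\<in>I. w i * (min (d i) r)\<^sup>2)) {0..r}"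
    by (intro has_integral_sum fin has_integral_mult_right int1)
  then have "J \<le> (\<Sum>i\<in>I. w i * (min (d i) r)\<^sup>2)"
  proof (rule has_integral_le[OF J])
    fix t assume t: "t \<in> {0..r}"
    have "sum w I - F t \<le> sum w I - (\<Sum>i | i \<in> I \<and> d i \<le> t. w i)"
      using F t by simp
    also have "\<dots> = (\<Sum>i\<in>I. w i * (if d i \<le> t then 0 else 1))"
    proof -
      have "(\<Sum>i | i \<in> I \<and> d i \<le> t. w i) = (\<Sum>i\<in>I. if d i \<le> t then w i else 0)"
        using fin by (simp add: sum.inter_filter)
      then show ?thesis by (auto simp flip: sum_subtractf intro!: sum.cong)
    qed
    finally have "2 * t * (sum w I - F t) \<le> 2 * t * (\<Sum>i\<in>I. w i * (if d i \<le> t then 0 else 1))"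
      using t by (intro mult_left_mono) auto
    also have "\<dots> = (\<Sum>i\<in>I. w i * (if d i \<le> t then 0 else 2 * t))"
      by (auto simp: sum_distrib_left intro!: sum.cong)
    \<comment> \<open>Only an inequality: an index with \<open>d i = t\<close> counts on the right
      but not on the left.\<close>
    also have "\<dots> \<le> (\<Sum>i\<in>I. w i * (if t \<in> {0..min (d i) r} then 2 * t else 0))"
      using t w by (intro sum_mono mult_left_mono) auto
    finally show "2 * t * (sum w I - F t)
      \<le> (\<Sum>i\<in>I. w i * (if t \<in> {0..min (d i) r} then 2 * t else 0))" .
  qed
  also have "\<dots> \<le> (\<Sum>i\<in>I. w i * (d i)\<^sup>2)"
    using w d r by (intro sum_mono mult_left_mono power_mono) auto
  finally show ?thesis .
qed

text \<open>The half-open unit cube with lowest corner \<open>k - c\<close> has volume 1 and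
  diagonal \<open>sqrt (card I)\<close>, so it stays in the enlarged ball centred at the origin.
  Comparing volumes gives the count.\<close>

lemma card_lattice_points_in_ball:
  fixes A :: "('i \<Rightarrow> int) set" and c :: "'i \<Rightarrow> real"
  assumes fin: "finite I" "finite A" and ext: "A \<subseteq> extensional I"
    and ball: "\<And>k. k \<in> A \<Longrightarrow> L2_set (\<lambda>i. real_of_int (k i) - c i) I \<le> \<rho>"
    and pos: "0 < \<rho> + sqrt (card I)"
  shows "real (card A) \<le> unit_ball_vol (real (card I)) * (\<rho> + sqrt (card I)) ^ card I"
proof -
  define M :: "('i \<Rightarrow> real) measure" where "M = Pi\<^sub>M I (\<lambda>_. lborel)"
  define C where "C k = Pi\<^sub>E I (\<lambda>i. {real_of_int (k i) - c i ..< real_of_int (k i) - c i + 1})"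
    for k :: "'i \<Rightarrow> int"
  define B where "B = {f :: 'i \<Rightarrow> real. sqrt (\<Sum>i\<in>I. (f i)\<^sup>2) \<le> \<rho> + sqrt (card I)} \<inter> space M"
  interpret product_sigma_finite "\<lambda>_ :: 'i. lborel :: real measure"
    by standard
  have Csets: "C k \<in> sets M" for k
    unfolding C_def M_def using fin by (intro sets_PiM_I_finite) auto
  have Cvol: "emeasure M (C k) = 1" for k
    unfolding C_def M_def using fin by (subst emeasure_PiM) auto
  have Bvol: "emeasure M B = ennreal (unit_ball_vol (real (card I)) * (\<rho> + sqrt (card I)) ^ card I)"
    unfolding B_def M_def using emeasure_cball_aux[OF fin(1) pos] .
  have Bsets: "B \<in> sets M"
    unfolding B_def M_def by measurable
  have disj: "disjoint_family_on C A"
    unfolding disjoint_family_on_def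
  proof (intro ballI impI)
    fix k l assume kl: "k \<in> A" "l \<in> A" "k \<noteq> l"
    \<comment> \<open>Rounding down recovers the lattice point from any point of its cube, and
      \<open>ext\<close> fixes its values outside \<open>I\<close>.\<close>
    have "k = l" if "f \<in> C k" "f \<in> C l" for f
    proof (rule extensionalityI[of k I])
      fix i assume "i \<in> I"
      then have "\<lfloor>f i + c i\<rfloor> = k i" "\<lfloor>f i + c i\<rfloor> = l i"
        using that by (auto simp: C_def PiE_iff floor_eq_iff dest!: bspec[of _ _ i])
      then show "k i = l i" by simp
    qed (use kl ext in auto)
    then show "C k \<inter> C l = {}" using kl by blast
  qed
  have sub: "C k \<subseteq> B" if "k \<in> A" for k
  proof
    fix f assume f: "f \<in> C k"
    have "L2_set f I = L2_set (\<lambda>i. (real_of_int (k i) - c i) + (f i - (real_of_int (k i) - c i))) I"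
      by simp
    also have "\<dots> \<le> L2_set (\<lambda>i. real_of_int (k i) - c i) I
        + L2_set (\<lambda>i. f i - (real_of_int (k i) - c i)) I"
      by (rule L2_set_triangle_ineq)
    also have "L2_set (\<lambda>i. f i - (real_of_int (k i) - c i)) I \<le> L2_set (\<lambda>_. 1) I"
      by (rule L2_set_mono) (use f in \<open>auto simp: C_def PiE_iff dest!: bspec\<close>)
    also have "\<dots> = sqrt (card I)" by (simp add: L2_set_constant)
    finally have "L2_set f I \<le> \<rho> + sqrt (card I)" using ball[OF that] by simp
    then show "f \<in> B"
      using sets.sets_into_space[OF Csets[of k]] f by (auto simp: B_def L2_set_def)
  qed
  have "ennreal (card A) = (\<Sum>k\<in>A. emeasure M (C k))"
    by (simp add: Cvol ennreal_of_nat_eq_real_of_nat)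
  also have "\<dots> = emeasure M (\<Union>k\<in>A. C k)"
    by (rule sum_emeasure[OF _ disj fin(2)]) (use Csets in auto)
  also have "\<dots> \<le> emeasure M B"
    by (rule emeasure_mono[OF _ Bsets]) (use sub in auto)
  finally show ?thesis
    unfolding Bvol using pos by (subst (asm) ennreal_le_iff) auto
qed

text \<open>The right-hand side is the product (M + 1) ... (M + n). The binomial coefficient will
  count the compositions.\<close>

lemma power_le_fact_mult_choose: "M ^ n \<le> fact n * ((M + n) choose n)"
proof (induction n)
  case (Suc n)
  have "M ^ Suc n \<le> (M + Suc n) * (fact n * ((M + n) choose n))"
    unfolding power_Suc by (rule mult_le_mono[OF _ Suc]) simp
  also have "\<dots> = fact n * (Suc (M + n) * ((M + n) choose n))"
    by (simp add: algebra_simps)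
  also have "\<dots> = fact n * ((Suc (M + n) choose Suc n) * Suc n)"
    by (subst Suc_times_binomial_eq) simp
  also have "\<dots> = fact (Suc n) * ((M + Suc n) choose Suc n)" by (simp add: algebra_simps)
  finally show ?case .
qed simp

section \<open>Compositions and the symmetric channel\<close>

text \<open>Parts may be 0, so after division by \<open>M\<close> the lists form a grid on the whole
  closed simplex.\<close>

definition compositions :: "nat \<Rightarrow> nat \<Rightarrow> nat list set" where
  "compositions q M = {l. length l = q \<and> sum_list l = M}"

lemma finite_compositions [simp]: "finite (compositions q M)"
proof (rule finite_subset)
  show "compositions q M \<subseteq> {l. set l \<subseteq> {..M} \<and> length l = q}"
    by (auto simp: compositions_def dest: member_le_sum_list)
qed (rule finite_lists_length_eq, simp)

lemma permute_list_compositions: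
  assumes "l \<in> compositions q M" "\<pi> permutes {..<q}"
  shows "permute_list \<pi> l \<in> compositions q M"
proof -
  have "mset (permute_list \<pi> l) = mset l"
    using assms by (intro mset_permute_list) (auto simp: compositions_def)
  then have "sum_list (permute_list \<pi> l) = sum_list l"
    by (metis sum_mset_sum_list)
  then show ?thesis using assms by (simp add: compositions_def)
qed

lemma permute_list_transpose_involution:
  assumes "x < length l" "x' < length l"
  shows "permute_list (Transposition.transpose x x') (permute_list (Transposition.transpose x x') l) = l"
proof -
  have "Transposition.transpose x x' permutes {..<length l}"
    using assms by (intro permutes_swap_id) auto
  from permute_list_compose[OF this, of "Transposition.transpose x x'"] show ?thesis
    by simp
qed

lemma sum_compositions_nth_swap:
  assumes "x < q" "x' < q"
  shows "(\<Sum>l\<in>compositions q M. f (l ! x)) = (\<Sum>l\<in>compositions q M. f (l ! x'))"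
proof -
  let ?T = "permute_list (Transposition.transpose x x') :: nat list \<Rightarrow> nat list"
  show ?thesis
  proof (rule sum.reindex_bij_witness[of _ ?T ?T])
  have perm: "Transposition.transpose x x' permutes {..<q}"
    using assms by (intro permutes_swap_id) auto
  fix l assume l: "l \<in> compositions q M"
  then have len: "length l = q" by (simp add: compositions_def)
  show "?T (?T l) = l" "?T (?T l) = l"
    using assms len by (auto intro!: permute_list_transpose_involution)
  show "?T l \<in> compositions q M" "?T l \<in> compositions q M"
    using permute_list_compositions[OF l perm] by auto
  show "f (?T l ! x') = f (l ! x)"
    using perm len assms by (simp add: permute_list_nth)
  qed
qed

text \<open>By symmetry all coordinates have the same total, and each composition contributes
  \<open>M\<close> to their sum. This makes the rows of the channel sum to 1.\<close>

lemma sum_compositions_nth: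
  assumes "x < q"
  shows "real q * (\<Sum>l\<in>compositions q M. real (l ! x)) = real M * real (card (compositions q M))"
proof -
  have "real q * (\<Sum>l\<in>compositions q M. real (l ! x)) = (\<Sum>x'<q. \<Sum>l\<in>compositions q M. real (l ! x'))"
    using sum_compositions_nth_swap[OF _ assms, where f = real] by simp
  also have "\<dots> = (\<Sum>l\<in>compositions q M. \<Sum>x'<q. real (l ! x'))"
    by (rule sum.swap)
  also have "\<dots> = (\<Sum>l\<in>compositions q M. real M)"
    by (intro sum.cong refl)
       (auto simp: compositions_def sum_list_sum_nth atLeast0LessThan)
  finally show ?thesis by simp
qed

lemma power_le_fact_card_compositions:
  "M ^ n \<le> fact n * card (compositions (Suc n) M)"
  using power_le_fact_mult_choose[of M n] card_length_sum_list[of "Suc n" M]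
    binomial_symmetric[of n "M + n"]
  by (simp add: compositions_def)

lemma card_compositions_pos: "0 < q \<Longrightarrow> 0 < card (compositions q M)"
  using card_length_sum_list[of q M] by (simp add: compositions_def)

text \<open>Outputs are equiprobable, and the posterior distribution given the output \<open>l\<close> is \<open>l / M\<close>.\<close>

definition composition_channel :: "nat \<Rightarrow> nat \<Rightarrow> nat \<Rightarrow> nat \<Rightarrow> real" where
  "composition_channel q M x y =
     real q * (1 / real (card (compositions q M))) * (real ((from_nat y :: nat list) ! x) / real M)"

text \<open>Lists are coded as numbers because \<open>degrading_cost\<close> ranges over output
  alphabets of type \<open>nat set\<close>.\<close>

definition composition_outputs :: "nat \<Rightarrow> nat \<Rightarrow> nat set" where
  "composition_outputs q M = to_nat ` compositions q M"

lemma sum_composition_outputs: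
  "(\<Sum>y\<in>composition_outputs q M. f y) = (\<Sum>l\<in>compositions q M. f (to_nat l))"
  unfolding composition_outputs_def by (subst sum.reindex) (auto simp: inj_on_def)

lemma channel_composition_channel:
  assumes "0 < q" "0 < M"
  shows "channel {..<q} (composition_outputs q M) (composition_channel q M)"
  unfolding channel_def
proof (intro conjI ballI)
  fix x assume "x \<in> {..<q}"
  then have "x < q" by simp
  have "(\<Sum>y\<in>composition_outputs q M. composition_channel q M x y) =
    1 / (real M * real (card (compositions q M))) * (real q * (\<Sum>l\<in>compositions q M. real (l ! x)))"
    by (simp add: sum_composition_outputs composition_channel_def sum_distrib_left mult_ac)
  also have "\<dots> = 1"
    unfolding sum_compositions_nth[OF \<open>x < q\<close>]
    using assms card_compositions_pos[of q M] by (simp del: card_0_eq)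
  finally show "(\<Sum>y\<in>composition_outputs q M. composition_channel q M x y) = 1" .
qed (auto simp: composition_channel_def composition_outputs_def)

text \<open>A block consists of the compositions with a common multiset of parts. Swapping two
  coordinates of the lists exchanges two rows; two columns of a block are rearrangements of each
  other.\<close>

lemma symmetric_composition_channel:
  assumes "0 < q" "0 < M"
  shows "symmetric_channel {..<q} (composition_outputs q M) (composition_channel q M)"
proof -
  define B where "B m = to_nat ` {l \<in> compositions q M. mset l = m}" for m
  define \<P> where "\<P> = B ` mset ` compositions q M"
  show ?thesis
    unfolding symmetric_channel_def
  proof (intro conjI exI[of _ \<P>] ballI channel_composition_channel[OF assms])
    show "partition_on (composition_outputs q M) \<P>"
    proof (rule partition_onI)
      show "\<Union>\<P> = composition_outputs q M"
        by (auto simp: \<P>_def B_def composition_outputs_def)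
      show "disjnt p p'" if "p \<in> \<P>" "p' \<in> \<P>" "p \<noteq> p'" for p p'
        using that by (auto simp: \<P>_def B_def disjnt_def)
    qed (auto simp: \<P>_def B_def)
    fix C assume "C \<in> \<P>"
    then obtain m where C: "C = B m" by (auto simp: \<P>_def)
    show "\<exists>\<pi>. \<pi> permutes C \<and> (\<forall>y\<in>C. composition_channel q M x' y = composition_channel q M x (\<pi> y))"
      if x: "x \<in> {..<q}" "x' \<in> {..<q}" for x x'
    proof -
      define T where "T = (permute_list (Transposition.transpose x x') :: nat list \<Rightarrow> nat list)"
      \<comment> \<open>The coordinate swap on coded lists, extended by the identity so that it
        permutes \<open>C\<close>.\<close>
      define \<pi> where "\<pi> y = (if y \<in> C then to_nat (T (from_nat y)) else y)" for y :: nat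
      have perm: "Transposition.transpose x x' permutes {..<q}"
        using x by (intro permutes_swap_id) auto
      have T: "T l \<in> compositions q M" "mset (T l) = mset l" "T (T l) = l" "T l ! x = l ! x'"
        if "l \<in> compositions q M" for l
      proof -
        have len: "length l = q" using that by (simp add: compositions_def)
        show "T l \<in> compositions q M"
          unfolding T_def by (rule permute_list_compositions[OF that perm])
        show "mset (T l) = mset l" unfolding T_def using perm len by simp
        show "T (T l) = l" unfolding T_def using x len by (simp add: permute_list_transpose_involution)
        show "T l ! x = l ! x'" unfolding T_def using x len perm by (simp add: permute_list_nth)
      qed
      have \<pi>C: "\<pi> y \<in> C" "\<pi> (\<pi> y) = y" if "y \<in> C" for y
      proof -
        obtain l where l: "y = to_nat l" "l \<in> compositions q M" "mset l = m"
          using \<open>y \<in> C\<close> unfolding C B_def by blast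
        then show "\<pi> y \<in> C" using that T[OF l(2)] by (auto simp: \<pi>_def C B_def)
        then show "\<pi> (\<pi> y) = y" using that l T[OF l(2)] by (simp add: \<pi>_def)
      qed
      have "bij_betw \<pi> C C"
        by (rule bij_betw_byWitness[of _ \<pi>]) (use \<pi>C in auto)
      then have "\<pi> permutes C"
        by (rule bij_imp_permutes) (simp add: \<pi>_def)
      moreover have "composition_channel q M x' y = composition_channel q M x (\<pi> y)" if "y \<in> C" for y
      proof -
        have "from_nat y \<in> compositions q M" using that by (auto simp: C B_def)
        then show ?thesis using that T(4) by (simp add: composition_channel_def \<pi>_def)
      qed
      ultimately show ?thesis by blast
    qed
    show "\<exists>\<pi>. \<pi> permutes {..<q} \<and>
        (\<forall>x\<in>{..<q}. composition_channel q M x y' = composition_channel q M (\<pi> x) y)"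
      if "y \<in> C" "y' \<in> C" for y y'
    proof -
      obtain l l' where l: "y = to_nat l" "l \<in> compositions q M" "mset l = m"
          "y' = to_nat l'" "l' \<in> compositions q M" "mset l' = m"
        using \<open>y \<in> C\<close> \<open>y' \<in> C\<close> unfolding C B_def by blast
      obtain \<pi> where "\<pi> permutes {..<length l}" "permute_list \<pi> l = l'"
        using mset_eq_permutation[of l' l] l by auto
      then show ?thesis
        using l permute_list_nth[of \<pi> l]
        by (intro exI[of _ \<pi>]) (auto simp: composition_channel_def compositions_def)
    qed
  qed
qed

text \<open>A composition is determined by its first \<open>n\<close> parts, so the compositions embed into the
  \<open>n\<close>-dimensional lattice.\<close>

lemma card_compositions_in_ball:
  fixes c :: "nat \<Rightarrow> real"
  assumes n: "0 < n" and M: "0 < M" and t: "0 \<le> t"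
  shows "real (card {l \<in> compositions (Suc n) M. L2_set (\<lambda>i. real (l ! i) / real M - c i) {..<n} \<le> t})
    \<le> unit_ball_vol (real n) * (real M * t + sqrt n) ^ n"
proof -
  define A where "A = {l \<in> compositions (Suc n) M. L2_set (\<lambda>i. real (l ! i) / real M - c i) {..<n} \<le> t}"
  \<comment> \<open>The restriction makes the lattice points extensional, as the counting lemma
    requires.\<close>
  define e :: "nat list \<Rightarrow> nat \<Rightarrow> int" where "e l = restrict (\<lambda>i. int (l ! i)) {..<n}" for l
  have inj: "inj_on e A"
  proof (rule inj_onI)
    fix l l' assume ll: "l \<in> A" "l' \<in> A" "e l = e l'"
    then have comp: "length l = Suc n" "length l' = Suc n" "sum_list l = sum_list l'"
      by (auto simp: A_def compositions_def)
    have nth: "l ! i = l' ! i" if "i < n" for i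
      using fun_cong[OF ll(3), of i] that by (simp add: e_def)
    moreover have "l ! n = l' ! n"
      using comp nth by (simp add: sum_list_sum_nth)
    ultimately show "l = l'"
      using comp by (auto intro!: nth_equalityI simp: less_Suc_eq)
  qed
  have "real (card (e ` A)) \<le> unit_ball_vol (real (card {..<n})) * (real M * t + sqrt (card {..<n})) ^ card {..<n}"
  \<comment> \<open>Scaling by \<open>M\<close> turns posteriors into lattice points and moves the
    centre to \<open>M\<close> times \<open>c\<close>.\<close>
  proof (rule card_lattice_points_in_ball[where c = "\<lambda>i. real M * c i"])
    fix k assume "k \<in> e ` A"
    then obtain l where l: "l \<in> A" "k = e l" by auto
    have "L2_set (\<lambda>i. real_of_int (k i) - real M * c i) {..<n} =
      L2_set (\<lambda>i. real M * (real (l ! i) / real M - c i)) {..<n}"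
      using l M by (intro L2_set_cong) (auto simp: e_def right_diff_distrib)
    also have "\<dots> = real M * L2_set (\<lambda>i. real (l ! i) / real M - c i) {..<n}"
      by (simp add: L2_set_right_distrib)
    also have "\<dots> \<le> real M * t"
      using l by (intro mult_left_mono) (auto simp: A_def)
    finally show "L2_set (\<lambda>i. real_of_int (k i) - real M * c i) {..<n} \<le> real M * t" .
  next
    show "0 < real M * t + sqrt (card {..<n})"
      using n t by (intro add_nonneg_pos) auto
  qed (auto simp: A_def e_def)
  then show ?thesis
    using card_image[OF inj] by (simp add: A_def)
qed

section \<open>The tail integral and its limit\<close>

text \<open>\<open>H\<close> is an antiderivative of \<open>2 (s - \<delta>) (1 - K s^n)\<close>, the integrand of the tail bound after the
  substitution \<open>s = t + \<delta>\<close>.\<close>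

definition quantization_bound :: "nat \<Rightarrow> real \<Rightarrow> real \<Rightarrow> real \<Rightarrow> real" where
  "quantization_bound n K r \<delta> =
    (let H = (\<lambda>s. s\<^sup>2 - 2 * \<delta> * s - 2 * K * (s ^ Suc (Suc n) / Suc (Suc n)) + 2 * \<delta> * K * (s ^ Suc n / Suc n))
     in (H (r + \<delta>) - H \<delta>) / 2)"

text \<open>The factor 2 appears because \<open>quantization_bound\<close> already includes the 1 /
  2 of the quadratic loss bound.\<close>

lemma has_integral_quantization_bound:
  assumes "0 \<le> r"
  shows "((\<lambda>t. 2 * t * (1 - K * (t + \<delta>) ^ n)) has_integral 2 * quantization_bound n K r \<delta>) {0..r}"
proof -
  define H where "H s = s\<^sup>2 - 2 * \<delta> * s - 2 * K * (s ^ Suc (Suc n) / Suc (Suc n)) + 2 * \<delta> * K * (s ^ Suc n / Suc n)"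
    for s :: real
  have pow: "((\<lambda>s. s ^ Suc k / real (Suc k)) has_real_derivative s ^ k) (at s)" for k and s :: real
    using DERIV_cdivide[OF DERIV_pow[of "Suc k" s], of "real (Suc k)"] by (simp del: of_nat_Suc)
  have "(H has_real_derivative 2 * s - 2 * \<delta> * 1 - 2 * K * s ^ Suc n + 2 * \<delta> * K * s ^ n) (at s)" for s
    unfolding H_def
    by (intro DERIV_add DERIV_diff DERIV_cmult pow DERIV_ident)
       (use DERIV_pow[of 2 s] in simp)
  then have deriv: "(H has_real_derivative 2 * (s - \<delta>) * (1 - K * s ^ n)) (at s)" for s
    by (rule DERIV_cong) (simp add: algebra_simps)
  have "((\<lambda>t. H (t + \<delta>)) has_real_derivative 2 * t * (1 - K * (t + \<delta>) ^ n)) (at t)" for t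
    using deriv[of "t + \<delta>"] by (subst DERIV_shift[symmetric]) simp
  then have "((\<lambda>t. 2 * t * (1 - K * (t + \<delta>) ^ n)) has_integral (H (r + \<delta>) - H (0 + \<delta>))) {0..r}"
    using assms by (intro fundamental_theorem_of_calculus)
      (auto simp flip: has_real_derivative_iff_has_vector_derivative intro: DERIV_subset)
  moreover have "quantization_bound n K r \<delta> = (H (r + \<delta>) - H \<delta>) / 2"
    by (simp only: quantization_bound_def H_def Let_def)
  ultimately show ?thesis by (simp add: mult.commute)
qed

text \<open>The bound is polynomial in its last argument, so the limit is its value at 0, half of
  r^2 - 2 r^2 / (n + 2). The hypothesis says that the tail bound 1 - K t^n reaches 0 at
  \<open>r\<close>.\<close>

lemma tendsto_quantization_bound:
  assumes "K * r ^ n = 1"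
  shows "(quantization_bound n K r \<longlongrightarrow> real n / (2 * (real n + 2)) * r\<^sup>2) (at 0)"
proof -
  have "isCont (quantization_bound n K r) 0"
    unfolding quantization_bound_def Let_def by (intro continuous_intros) auto
  moreover have "quantization_bound n K r 0 = (r\<^sup>2 - 2 * (K * r ^ n) * r\<^sup>2 / (n + 2)) / 2"
    by (simp add: quantization_bound_def power_add power2_eq_square mult_ac)
  then have "quantization_bound n K r 0 = real n / (2 * (real n + 2)) * r\<^sup>2"
    unfolding assms by (simp add: field_simps)
  ultimately show ?thesis by (simp add: isCont_def)
qed

section \<open>Loss of the composition channel and conclusion\<close>

text \<open>Randomised degradations are handled directly: each pair of \<open>z\<close> and
  \<open>y\<close> is a point of weight \<open>\<Phi> y z / N\<close>, at the distance of the
  posterior of \<open>y\<close> from the centre of \<open>z\<close>. As \<open>\<Phi> y z\<close> is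
  at most 1, a ball about one centre carries at most its share of the posteriors, and summing over
  the centres gives the factor \<open>L\<close> in \<open>K\<close>.\<close>

lemma min_degrading_loss_composition_channel_ge:
  fixes n M L :: nat and r :: real
  assumes n: "0 < n" and M: "0 < M" and L: "1 \<le> L" and r: "0 \<le> r"
  defines "K \<equiv> real L * unit_ball_vol (real n) * fact n"
  shows "ereal (quantization_bound n K r (sqrt n / M)) \<le>
    min_degrading_loss {..<Suc n} (\<lambda>_. 1 / real (Suc n)) L
      (composition_outputs (Suc n) M) (composition_channel (Suc n) M)"
  unfolding min_degrading_loss_def
proof (rule INF_greatest, clarify)
  define Y where "Y = composition_outputs (Suc n) M"
  define W where "W = composition_channel (Suc n) M"
  define N where "N = card (compositions (Suc n) M)"
  define p where "p x y = real ((from_nat y :: nat list) ! x) / real M" for x y :: nat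
  \<comment> \<open>The diagonal of a unit cube in dimension \<open>n\<close>, rescaled by 1 /
    M.\<close>
  define \<delta> where "\<delta> = sqrt n / M"
  fix Z :: "nat set" and Q
  assume Q: "channel {..<Suc n} Z Q" and deg: "degraded {..<Suc n} (composition_outputs (Suc n) M)
      (composition_channel (Suc n) M) Z Q" and Z: "card Z \<le> L"
  obtain \<Phi> where \<Phi>: "channel Y Z \<Phi>"
    and QW: "\<And>x z. x \<in> {..<Suc n} \<Longrightarrow> z \<in> Z \<Longrightarrow> Q x z = (\<Sum>y\<in>Y. W x y * \<Phi> y z)"
    using deg by (auto simp: degraded_def Y_def W_def)
  have Npos: "0 < N" unfolding N_def by (rule card_compositions_pos) simp
  have W: "channel {..<Suc n} Y W"
    unfolding W_def Y_def using M by (intro channel_composition_channel) auto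
  have fin: "finite Y" "finite Z" using W Q by (auto simp: channel_def)
  have cardY: "card Y = N"
    unfolding Y_def N_def composition_outputs_def by (rule card_image) (simp add: inj_on_def)
  have p1: "(\<Sum>x<Suc n. p x y) = 1" if "y \<in> Y" for y
    using that M
    by (auto simp: p_def Y_def composition_outputs_def compositions_def sum_list_sum_nth
          atLeast0LessThan simp flip: sum_divide_distrib of_nat_sum simp del: sum.lessThan_Suc)
  have "\<exists>c. (\<Sum>z\<in>Z. \<Sum>y\<in>Y. 1 / N * \<Phi> y z * (\<Sum>x<Suc n. (p x y - c x z)\<^sup>2)) / 2
      \<le> channel_mi {..<Suc n} (\<lambda>_. 1 / real (card {..<Suc n})) Y W
        - channel_mi {..<Suc n} (\<lambda>_. 1 / real (card {..<Suc n})) Z Q"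
    by (rule degrading_loss_ge_quadratic[OF W _ _ _ _ p1 Q \<Phi> QW])
       (auto simp: W_def composition_channel_def p_def N_def)
  then obtain c where c: "(\<Sum>z\<in>Z. \<Sum>y\<in>Y. 1 / N * \<Phi> y z * (\<Sum>x<Suc n. (p x y - c x z)\<^sup>2)) / 2
      \<le> channel_mi {..<Suc n} (\<lambda>_. 1 / real (card {..<Suc n})) Y W
        - channel_mi {..<Suc n} (\<lambda>_. 1 / real (card {..<Suc n})) Z Q" ..
  define w where "w = (\<lambda>(z, y). 1 / N * \<Phi> y z)"
  \<comment> \<open>Only \<open>n\<close> of the \<open>n + 1\<close> coordinates enter, to match
    the lattice dimension; dropping the last one can only lower the squared distance.\<close>
  define d where "d = (\<lambda>(z, y). L2_set (\<lambda>i. p i y - c i z) {..<n})"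
  have \<Phi>0: "0 \<le> \<Phi> y z" if "y \<in> Y" "z \<in> Z" for y z
    using \<Phi> that by (simp add: channel_def)
  have \<Phi>1: "\<Phi> y z \<le> 1" if "y \<in> Y" "z \<in> Z" for y z
    using \<Phi> that member_le_sum[of z Z "\<Phi> y"] by (auto simp: channel_def)
  have w1: "sum w (Z \<times> Y) = 1"
  proof -
    have "sum w (Z \<times> Y) = (\<Sum>z\<in>Z. \<Sum>y\<in>Y. 1 / N * \<Phi> y z)"
      by (simp add: w_def sum.cartesian_product)
    also have "\<dots> = (\<Sum>y\<in>Y. 1 / N * (\<Sum>z\<in>Z. \<Phi> y z))"
      by (subst sum.swap) (simp add: sum_distrib_left)
    also have "\<dots> = 1"
      using \<Phi> Npos by (simp add: channel_def cardY)
    finally show ?thesis .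
  qed
  have F: "(\<Sum>i | i \<in> Z \<times> Y \<and> d i \<le> t. w i) \<le> K * (t + \<delta>) ^ n" if t: "0 \<le> t" for t
  proof -
    define D where "D z = {y \<in> Y. d (z, y) \<le> t}" for z
    have MN: "1 / real N \<le> fact n / real M ^ n"
    proof -
      have "real M ^ n \<le> fact n * real N"
        using power_le_fact_card_compositions[of M n] unfolding N_def
        by (metis of_nat_fact of_nat_le_iff of_nat_mult of_nat_power)
      then show ?thesis using M Npos by (simp add: field_simps)
    qed
    have card_D: "real (card (D z)) \<le> unit_ball_vol (real n) * (real M * t + sqrt n) ^ n" for z
    proof -
      have "D z = to_nat `
          {l \<in> compositions (Suc n) M. L2_set (\<lambda>i. real (l ! i) / real M - c i z) {..<n} \<le> t}"
        by (auto simp: D_def Y_def composition_outputs_def d_def p_def)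
      then have "card (D z) =
          card {l \<in> compositions (Suc n) M. L2_set (\<lambda>i. real (l ! i) / real M - c i z) {..<n} \<le> t}"
        by (simp add: card_image inj_on_def)
      then show ?thesis using card_compositions_in_ball[OF n M t] by simp
    qed
    have "(\<Sum>i | i \<in> Z \<times> Y \<and> d i \<le> t. w i) = (\<Sum>i\<in>Sigma Z D. w i)"
      by (intro sum.cong) (auto simp: D_def)
    also have "\<dots> = (\<Sum>z\<in>Z. \<Sum>y\<in>D z. 1 / N * \<Phi> y z)"
      unfolding w_def using fin by (intro sum.Sigma[symmetric]) (auto simp: D_def)
    also have "\<dots> \<le> (\<Sum>z\<in>Z. \<Sum>y\<in>D z. 1 / N)"
      using \<Phi>1 Npos by (intro sum_mono) (auto simp: D_def divide_right_mono)
    also have "\<dots> = (\<Sum>z\<in>Z. card (D z) * (1 / N))"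
      by simp
    also have "\<dots> \<le> (\<Sum>z\<in>Z. unit_ball_vol (real n) * (real M * t + sqrt n) ^ n * (fact n / real M ^ n))"
      using t by (intro sum_mono mult_mono card_D MN) auto
    also have "\<dots> = card Z * (unit_ball_vol (real n) * fact n * (t + \<delta>) ^ n)"
    proof -
      have "real M * t + sqrt n = real M * (t + \<delta>)"
        using M by (simp add: \<delta>_def distrib_left)
      then show ?thesis using M by (simp add: power_mult_distrib)
    qed
    also have "\<dots> \<le> L * (unit_ball_vol (real n) * fact n * (t + \<delta>) ^ n)"
      using t Z by (intro mult_right_mono) (auto simp: \<delta>_def)
    finally show ?thesis by (simp add: K_def mult.assoc)
  qed
  have "2 * quantization_bound n K r \<delta> \<le> (\<Sum>i\<in>Z \<times> Y. w i * (d i)\<^sup>2)"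
  proof (rule second_moment_layer_cake[OF _ _ _ r])
    show "((\<lambda>t. 2 * t * (sum w (Z \<times> Y) - K * (t + \<delta>) ^ n)) has_integral
        2 * quantization_bound n K r \<delta>) {0..r}"
      unfolding w1 by (rule has_integral_quantization_bound[OF r])
  qed (use F fin \<Phi>0 in \<open>auto simp: w_def d_def\<close>)
  also have "\<dots> = (\<Sum>z\<in>Z. \<Sum>y\<in>Y. 1 / N * \<Phi> y z * (\<Sum>x<n. (p x y - c x z)\<^sup>2))"
    unfolding sum.cartesian_product
    by (intro sum.cong refl) (auto simp: w_def d_def L2_set_def sum_nonneg)
  also have "\<dots> \<le> (\<Sum>z\<in>Z. \<Sum>y\<in>Y. 1 / N * \<Phi> y z * (\<Sum>x<Suc n. (p x y - c x z)\<^sup>2))"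
    using \<Phi>0 by (intro sum_mono mult_left_mono) auto
  finally show "ereal (quantization_bound n K r (sqrt n / M)) \<le>
     ereal (channel_mi {..<Suc n} (\<lambda>_. 1 / real (Suc n)) (composition_outputs (Suc n) M)
         (composition_channel (Suc n) M)
       - channel_mi {..<Suc n} (\<lambda>_. 1 / real (Suc n)) Z Q)"
    using c by (simp add: Y_def W_def \<delta>_def)
qed

theorem theorem2:
  fixes q L :: nat
  assumes "2 \<le> q" and "1 \<le> L"
  shows "ereal (dc_bound q L) \<le> degrading_cost q L \<and>
    (\<exists>(Y :: nat \<Rightarrow> nat set) (W :: nat \<Rightarrow> nat \<Rightarrow> nat \<Rightarrow> real).
       (\<forall>M. symmetric_channel {..<q} (Y M) (W M)) \<and>
       ereal (dc_bound q L)
         \<le> liminf (\<lambda>M. min_degrading_loss {..<q} (\<lambda>x. 1 / real q) L (Y M) (W M)))"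
proof -
  define n where "n = q - 1"
  have n: "0 < n" "q = Suc n" using assms by (auto simp: n_def)
  define K where "K = real L * unit_ball_vol (real n) * fact n"
  \<comment> \<open>Chosen such that \<open>K * r ^ n = 1\<close>: then \<open>L\<close> balls of
    radius \<open>r\<close> have total volume 1 / n!.\<close>
  define r where "r = (1 / (unit_ball_vol (real n) * fact n)) powr (1 / n) * (1 / real L) powr (1 / n)"
  have vol: "0 < unit_ball_vol (real n)" by simp
  then have "unit_ball_vol (real n) \<noteq> 0" by linarith
  have root: "(a powr (1 / n)) ^ n = a" "(a powr (1 / n))\<^sup>2 = a powr (2 / n)" if "0 < a" for a :: real
    using n that by (simp_all add: powr_power)
  have "r ^ n = 1 / (unit_ball_vol (real n) * fact n) * (1 / real L)"
    unfolding r_def power_mult_distrib using vol assms(2) by (subst (1 2) root) auto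
  then have Kr: "K * r ^ n = 1"
    using \<open>unit_ball_vol (real n) \<noteq> 0\<close> assms(2) by (simp add: K_def)
  have "r\<^sup>2 = (1 / (unit_ball_vol (real n) * fact n)) powr (2 / n) * (1 / real L) powr (2 / n)"
    unfolding r_def power_mult_distrib using vol assms(2) by (subst (1 2) root) auto
  then have bound: "dc_bound q L = real n / (2 * (real n + 2)) * r\<^sup>2"
    by (simp add: dc_bound_def n add_ac)
  \<comment> \<open>The shift to \<open>Suc M\<close> excludes the total 0, for which the transition
    probabilities would all be 0.\<close>
  define Y where "Y M = composition_outputs q (Suc M)" for M
  define W where "W M = composition_channel q (Suc M)" for M
  have sym: "symmetric_channel {..<q} (Y M) (W M)" for M
    unfolding Y_def W_def by (rule symmetric_composition_channel) (use n in auto)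
  have "((\<lambda>M. sqrt n / Suc M) \<longlongrightarrow> 0) sequentially"
    by real_asymp
  \<comment> \<open>The limit at 0 is punctured, so the arguments must be nonzero, which
    \<open>0 < n\<close> ensures.\<close>
  then have "filterlim (\<lambda>M. sqrt n / Suc M) (at 0) sequentially"
    using n by (auto simp: filterlim_at)
  then have "(\<lambda>M. quantization_bound n K r (sqrt n / Suc M)) \<longlonglongrightarrow> dc_bound q L"
    unfolding bound by (rule filterlim_compose[OF tendsto_quantization_bound[OF Kr]])
  then have "ereal (dc_bound q L) = liminf (\<lambda>M. ereal (quantization_bound n K r (sqrt n / Suc M)))"
    by (intro lim_imp_Liminf[symmetric] trivial_limit_sequentially tendsto_ereal)
  also have "\<dots> \<le> liminf (\<lambda>M. min_degrading_loss {..<q} (\<lambda>x. 1 / real q) L (Y M) (W M))"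
    unfolding K_def n(2) Y_def W_def
    by (intro Liminf_mono always_eventually allI min_degrading_loss_composition_channel_ge)
       (use n assms in \<open>auto simp: r_def\<close>)
  finally have lim: "ereal (dc_bound q L)
    \<le> liminf (\<lambda>M. min_degrading_loss {..<q} (\<lambda>x. 1 / real q) L (Y M) (W M))" .
  \<comment> \<open>The first claim follows from the second: every channel of the sequence competes
    in the supremum, so the limit inferior is at most \<open>degrading_cost q L\<close>.\<close>
  have "input_distribution {..<q} (\<lambda>x. 1 / real q)"
    using n by (simp add: input_distribution_def)
  then have "min_degrading_loss {..<q} (\<lambda>x. 1 / real q) L (Y M) (W M) \<le> degrading_cost q L" for M
    unfolding degrading_cost_def using sym[of M]
    by (intro SUP_upper2[of "(\<lambda>x. 1 / real q, Y M, W M)"]) (auto simp: symmetric_channel_def)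
  then have "liminf (\<lambda>M. min_degrading_loss {..<q} (\<lambda>x. 1 / real q) L (Y M) (W M)) \<le> degrading_cost q L"
    using Liminf_mono[of "\<lambda>M. min_degrading_loss {..<q} (\<lambda>x. 1 / real q) L (Y M) (W M)"
        "\<lambda>_. degrading_cost q L" sequentially]
    by (simp add: Liminf_const)
  then show ?thesis
    using lim sym by (meson order_trans)
qed

end
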